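(* Let $\rho_1$ be a convex expectation on $L^\infty(\mu)$ that is continuous from below. Then $$\mathcal{X}_\alpha=\{X\in L^\infty(\mu):K_1\le X\le K_2,\ \rho_1(X)\le\alpha\}$$ is compact in the weak$^*$ topology $\sigma(L^\infty(\mu),L^1(\mu))$.
   Context: $(\Omega,\mathcal{F},\mu)$ is a probability space. A convex expectation on $L^\infty(\mu)$ is a map $\rho:L^\infty(\mu)\to\mathbb{R}$ such that for all $X,Y\in L^\infty(\mu)$: (i) $X\ge Y$ implies $\rho(X)\ge\rho(Y)$; (ii) $\rho(X+c)=\rho(X)+c$ for every constant $c$; (iii) $\rho(\lambda X+(1-\lambda)Y)\le\lambda\rho(X)+(1-\lambda)\rho(Y)$ for $\lambda\in[0,1]$. It is continuous from below if $\rho(X_n)\to\rho(X)$ whenever $(X_n)\subset L^\infty(\mu)$ increases to $X\in L^\infty(\mu)$. $K_1,K_2\in L^\infty(\mu)$ are fixed with $0\le K_1<K_2$ ($\mu$-a.e.), and $\alpha$ is a fixed real number (significance level) with $\rho_1(K_1)\le\alpha\le\rho_1(K_2)$. *)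

theory Defs
  imports "HOL-Probability.Probability"
begin

text \<open>
  The carrier of \<open>L\<^sup>\<infinity>(M)\<close> is the set of almost-everywhere equivalence classes of
  essentially bounded measurable functions. The vector space operations and the order on classes
  are the ones induced by representatives.
\<close>

definition ess_bounded :: "'a measure \<Rightarrow> ('a \<Rightarrow> real) set" where
  "ess_bounded M = {f \<in> borel_measurable M. \<exists>C. AE x in M. \<bar>f x\<bar> \<le> C}"

definition ae_class :: "'a measure \<Rightarrow> ('a \<Rightarrow> real) \<Rightarrow> ('a \<Rightarrow> real) set" where
  "ae_class M f = {g \<in> borel_measurable M. AE x in M. g x = f x}"

definition Linf :: "'a measure \<Rightarrow> ('a \<Rightarrow> real) set set" where
  "Linf M = ae_class M ` ess_bounded M"

lemma ae_class_eq_iff: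
  assumes "f \<in> borel_measurable M"
  shows "ae_class M f = ae_class M g \<longleftrightarrow> (AE x in M. f x = g x)"
proof
  assume "ae_class M f = ae_class M g"
  moreover have "f \<in> ae_class M f"
    using assms by (simp add: ae_class_def)
  ultimately show "AE x in M. f x = g x"
    by (simp add: ae_class_def)
next
  assume *: "AE x in M. f x = g x"
  have "(AE x in M. h x = f x) \<longleftrightarrow> (AE x in M. h x = g x)" for h
    using * by (intro eventually_cong[OF *]) simp
  then show "ae_class M f = ae_class M g"
    by (simp add: ae_class_def)
qed

text \<open>
  The topology \<open>\<sigma>(L\<^sup>\<infinity>, L\<^sup>1)\<close>: the coarsest one on \<^term>\<open>Linf M\<close> for which every functional
  \<open>[f] \<mapsto> \<integral> f g dM\<close> with \<open>g\<close> integrable is continuous. The subbasis consists of the preimages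
  of open sets under these functionals.
\<close>

definition Linf_preimage ::
  "'a measure \<Rightarrow> ('a \<Rightarrow> real) \<Rightarrow> real set \<Rightarrow> ('a \<Rightarrow> real) set set" where
  "Linf_preimage M g U =
     {ae_class M f | f. f \<in> ess_bounded M \<and> (LINT x|M. f x * g x) \<in> U}"

definition Linf_weak_star :: "'a measure \<Rightarrow> ('a \<Rightarrow> real) set topology" where
  "Linf_weak_star M =
     topology_generated_by {Linf_preimage M g U | g U. integrable M g \<and> open U}"

lemma ae_class_in_Linf_preimage_iff:
  assumes "f \<in> ess_bounded M" "integrable M g"
  shows "ae_class M f \<in> Linf_preimage M g U \<longleftrightarrow> (LINT x|M. f x * g x) \<in> U"
proof
  assume "ae_class M f \<in> Linf_preimage M g U"
  then obtain h where h: "ae_class M f = ae_class M h" "h \<in> ess_bounded M"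
      "(LINT x|M. h x * g x) \<in> U"
    by (auto simp: Linf_preimage_def)
  have meas: "f \<in> borel_measurable M" "h \<in> borel_measurable M" "g \<in> borel_measurable M"
    using assms h(2) by (auto simp: ess_bounded_def)
  have "AE x in M. f x = h x"
    using h(1) ae_class_eq_iff[OF meas(1)] by blast
  then have "AE x in M. f x * g x = h x * g x"
    by eventually_elim simp
  then have "(LINT x|M. f x * g x) = (LINT x|M. h x * g x)"
    using meas by (intro integral_cong_AE) auto
  with h(3) show "(LINT x|M. f x * g x) \<in> U"
    by simp
next
  assume "(LINT x|M. f x * g x) \<in> U"
  with assms(1) show "ae_class M f \<in> Linf_preimage M g U"
    by (auto simp: Linf_preimage_def)
qed

lemma topspace_Linf_weak_star: "topspace (Linf_weak_star M) = Linf M"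
proof -
  have "Linf_preimage M g U \<subseteq> Linf M" for g U
    by (auto simp: Linf_preimage_def Linf_def)
  moreover have "Linf M = Linf_preimage M (\<lambda>_. 0) UNIV"
    by (auto simp: Linf_preimage_def Linf_def)
  moreover have "integrable M (\<lambda>_. 0::real)" "open (UNIV :: real set)"
    by simp_all
  ultimately show ?thesis
    unfolding Linf_weak_star_def topology_generated_by_topspace by blast
qed

text \<open>
  Only the values of \<open>\<rho>\<close> on \<^term>\<open>Linf M\<close> matter; its values on other sets of functions are junk.
\<close>

definition convex_expectation :: "'a measure \<Rightarrow> (('a \<Rightarrow> real) set \<Rightarrow> real) \<Rightarrow> bool" where
  "convex_expectation M \<rho> \<longleftrightarrow>
     (\<forall>X\<in>ess_bounded M. \<forall>Y\<in>ess_bounded M.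
        (AE x in M. X x \<ge> Y x) \<longrightarrow> \<rho> (ae_class M X) \<ge> \<rho> (ae_class M Y)) \<and>
     (\<forall>X\<in>ess_bounded M. \<forall>c::real. \<rho> (ae_class M (\<lambda>x. X x + c)) = \<rho> (ae_class M X) + c) \<and>
     (\<forall>X\<in>ess_bounded M. \<forall>Y\<in>ess_bounded M. \<forall>t\<in>{0..1::real}.
        \<rho> (ae_class M (\<lambda>x. t * X x + (1 - t) * Y x))
          \<le> t * \<rho> (ae_class M X) + (1 - t) * \<rho> (ae_class M Y))"

definition continuous_from_below :: "'a measure \<Rightarrow> (('a \<Rightarrow> real) set \<Rightarrow> real) \<Rightarrow> bool" where
  "continuous_from_below M \<rho> \<longleftrightarrow>
     (\<forall>(X :: nat \<Rightarrow> 'a \<Rightarrow> real) Y.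
        (\<forall>n. X n \<in> ess_bounded M) \<and> Y \<in> ess_bounded M \<and>
        (\<forall>n. AE x in M. X n x \<le> X (Suc n) x) \<and>
        (AE x in M. (\<lambda>n. X n x) \<longlonglongrightarrow> Y x) \<longrightarrow>
        (\<lambda>n. \<rho> (ae_class M (X n))) \<longlonglongrightarrow> \<rho> (ae_class M Y))"

end

theory Submission
  imports Defs
begin

text \<open>
  The set is weak-star closed and, because of \<open>0 \<le> K\<^sub>1 \<le> X \<le> K\<^sub>2\<close>, contained in a norm ball of
  \<open>L\<^sup>\<infinity>\<close>, and such balls are weak-star compact.

  Compactness of the ball (\<open>compactin_weak_star_ball\<close>) is the Banach-Alaoglu theorem together
  with the duality \<open>(L\<^sup>1)* = L\<^sup>\<infinity>\<close>. Bounded linear functionals on \<open>L\<^sup>1\<close> form a closed subset of a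
  product of compact intervals, and by Radon-Nikodym each of them is integration against a bounded
  density (\<open>L1_dual_bounded_density\<close>). The map from functionals to densities is continuous because
  the weak-star topology sees a density only through its integrals against \<open>L\<^sup>1\<close> functions.

  Closedness combines two facts. First, continuity from below and monotonicity give the
  Fatou property: if bounded \<open>X\<^sub>n\<close> converge to \<open>X\<close> almost everywhere, then the infima of the tails
  increase to \<open>X\<close> and stay below the \<open>X\<^sub>n\<close>, so \<open>\<rho>(X\<^sub>n) \<le> \<alpha>\<close> for all \<open>n\<close> implies \<open>\<rho>(X) \<le> \<alpha>\<close>
  (\<open>convex_expectation_Fatou\<close>). Hence the set is convex and closed under almost-everywhere
  convergence of sequences. Second, a convex, uniformly bounded set with this closure property is
  weak-star closed (\<open>closedin_weak_star_if_ae_closed\<close>). The Krein-Smulian theorem is the usual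
  tool here, but on a finite measure space boundedness allows Hilbert space geometry instead: a
  bounded \<open>h\<close> outside the set has a nearest point \<open>p\<close> in the set with respect to the \<open>L\<^sup>2\<close>
  distance, and integration against \<open>h - p\<close> strictly separates \<open>h\<close> from the set. Since \<open>h - p\<close> is
  bounded, it is integrable, so this functional is weak-star continuous.
\<close>

section \<open>Essentially bounded functions\<close>

lemma ess_boundedI:
  "f \<in> borel_measurable M \<Longrightarrow> AE x in M. \<bar>f x\<bar> \<le> C \<Longrightarrow> f \<in> ess_bounded M"
  by (auto simp: ess_bounded_def)

lemma ess_bounded_const [simp]: "(\<lambda>x. c) \<in> ess_bounded M"
  by (rule ess_boundedI[where C="\<bar>c\<bar>"]) auto

lemma ess_bounded_measurable: "f \<in> ess_bounded M \<Longrightarrow> f \<in> borel_measurable M"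
  by (simp add: ess_bounded_def)

lemma ess_bounded_add:
  assumes "f \<in> ess_bounded M" "g \<in> ess_bounded M"
  shows "(\<lambda>x. f x + g x) \<in> ess_bounded M"
proof -
  obtain C D where "AE x in M. \<bar>f x\<bar> \<le> C" "AE x in M. \<bar>g x\<bar> \<le> D"
    using assms by (auto simp: ess_bounded_def)
  then have "AE x in M. \<bar>f x + g x\<bar> \<le> C + D" by eventually_elim simp
  then show ?thesis using assms by (intro ess_boundedI) (auto simp: ess_bounded_def)
qed

lemma ess_bounded_mult:
  assumes "f \<in> ess_bounded M" "g \<in> ess_bounded M"
  shows "(\<lambda>x. f x * g x) \<in> ess_bounded M"
proof -
  obtain C D where "AE x in M. \<bar>f x\<bar> \<le> C" "AE x in M. \<bar>g x\<bar> \<le> D"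
    using assms by (auto simp: ess_bounded_def)
  then have "AE x in M. \<bar>f x * g x\<bar> \<le> C * D"
  proof eventually_elim
    case (elim x)
    then show ?case
      unfolding abs_mult by (intro mult_mono) auto
  qed
  then show ?thesis using assms by (intro ess_boundedI) (auto simp: ess_bounded_def)
qed

lemma ess_bounded_diff:
  assumes "f \<in> ess_bounded M" "g \<in> ess_bounded M"
  shows "(\<lambda>x. f x - g x) \<in> ess_bounded M"
  using ess_bounded_add[OF assms(1) ess_bounded_mult[OF ess_bounded_const[of "-1"] assms(2)]]
  by simp

lemma ess_bounded_power2: "f \<in> ess_bounded M \<Longrightarrow> (\<lambda>x. (f x)\<^sup>2) \<in> ess_bounded M"
  using ess_bounded_mult[of f M f] by (simp add: power2_eq_square)

lemmas ess_bounded_intros =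
  ess_bounded_const ess_bounded_add ess_bounded_mult ess_bounded_diff ess_bounded_power2

lemma integral_mult_AE_bounded:
  fixes X g :: "'a \<Rightarrow> real"
  assumes g: "integrable M g" and X: "X \<in> borel_measurable M" "AE x in M. \<bar>X x\<bar> \<le> B"
  shows "integrable M (\<lambda>x. X x * g x)"
    and "\<bar>LINT x|M. X x * g x\<bar> \<le> B * (LINT x|M. \<bar>g x\<bar>)"
proof -
  have [measurable]: "g \<in> borel_measurable M" "X \<in> borel_measurable M"
    using g X by auto
  have le: "AE x in M. \<bar>X x * g x\<bar> \<le> B * \<bar>g x\<bar>"
    using X(2) by eventually_elim (simp add: abs_mult mult_right_mono)
  then have "AE x in M. norm (X x * g x) \<le> norm (B * \<bar>g x\<bar>)"
    by eventually_elim simp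
  then show int: "integrable M (\<lambda>x. X x * g x)"
    by (rule Bochner_Integration.integrable_bound[where f="\<lambda>x. B * \<bar>g x\<bar>", rotated 2]) (use g in auto)
  have "\<bar>LINT x|M. X x * g x\<bar> \<le> (LINT x|M. \<bar>X x * g x\<bar>)"
    by (rule integral_abs_bound)
  also have "\<dots> \<le> (LINT x|M. B * \<bar>g x\<bar>)"
    using int g le by (intro integral_mono_AE) auto
  finally show "\<bar>LINT x|M. X x * g x\<bar> \<le> B * (LINT x|M. \<bar>g x\<bar>)"
    by simp
qed

lemma (in finite_measure) integrable_ess_bounded:
  assumes "f \<in> ess_bounded M"
  shows "integrable M f"
proof -
  obtain C where "AE x in M. \<bar>f x\<bar> \<le> C"
    using assms by (auto simp: ess_bounded_def)
  with assms show ?thesis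
    by (intro integrable_const_bound[of f C]) (auto simp: ess_bounded_def)
qed

section \<open>The dual of the space of integrable functions\<close>

context finite_measure
begin

text \<open>
  The measure with density \<open>X\<close> has to be \<open>A \<mapsto> F (indicator A)\<close>. The bound on \<open>F\<close> makes this set
  function countably additive and absolutely continuous, and also bounds the density.
\<close>

lemma L1_dual_bounded_density:
  fixes F :: "('a \<Rightarrow> real) \<Rightarrow> real"
  assumes add: "\<And>f g. integrable M f \<Longrightarrow> integrable M g \<Longrightarrow> F (\<lambda>x. f x + g x) = F f + F g"
    and scale: "\<And>c f. integrable M f \<Longrightarrow> F (\<lambda>x. c * f x) = c * F f"
    and bound: "\<And>f. integrable M f \<Longrightarrow> \<bar>F f\<bar> \<le> B * (LINT x|M. \<bar>f x\<bar>)"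
    and "0 \<le> B"
  obtains X where "X \<in> borel_measurable M" "AE x in M. \<bar>X x\<bar> \<le> B"
    "\<And>f. integrable M f \<Longrightarrow> (LINT x|M. X x * f x) = F f"
proof -
  (* F may be signed. Adding B times the integral makes it positive, so that Radon-Nikodym applies;
     the shift is undone in X below. *)
  define \<nu> where "\<nu> A = F (indicator A) + B * measure M A" for A
  have ind: "integrable M (indicator A :: 'a \<Rightarrow> real)" if "A \<in> sets M" for A
    using that by (intro integrable_real_indicator) (auto simp: less_top[symmetric])
  have \<nu>_bounds: "0 \<le> \<nu> A" "\<nu> A \<le> 2 * B * measure M A" if "A \<in> sets M" for A
    using bound[OF ind[OF that]] that by (auto simp: \<nu>_def abs_le_iff)
  have \<nu>_add: "\<nu> (S \<union> T) = \<nu> S + \<nu> T" if "S \<in> sets M" "T \<in> sets M" "S \<inter> T = {}" for S T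
  proof -
    have "(indicator (S \<union> T) :: 'a \<Rightarrow> real) = (\<lambda>x. indicator S x + indicator T x)"
      using that(3) by (auto simp: indicator_def fun_eq_iff)
    then show ?thesis
      using add[OF ind ind, OF that(1,2)] finite_measure_Union[OF that]
      by (simp add: \<nu>_def algebra_simps)
  qed
  define N where "N = measure_of (space M) (sets M) (\<lambda>A. ennreal (\<nu> A))"
  have sets_N [simp, measurable_cong]: "sets N = sets M" and space_N: "space N = space M"
    by (simp_all add: N_def)
  have pos: "positive (sets M) (\<lambda>A. ennreal (\<nu> A))"
    using \<nu>_bounds(2)[of "{}"] by (simp add: positive_def ennreal_eq_0_iff)
  (* \<nu> is finitely additive and dominated by 2 * B times the measure M, so it inherits continuity at {}. *)
  have "countably_additive (sets M) (\<lambda>A. ennreal (\<nu> A))"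
  proof (rule sets.empty_continuous_imp_countably_additive)
    show "additive (sets M) (\<lambda>A. ennreal (\<nu> A))"
      using \<nu>_bounds(1) by (auto simp: additive_def \<nu>_add simp flip: ennreal_plus)
    fix A :: "nat \<Rightarrow> 'a set"
    assume A: "range A \<subseteq> sets M" "decseq A" "(\<Inter>i. A i) = {}"
    have "(\<lambda>i. measure M (A i)) \<longlonglongrightarrow> measure M (\<Inter>i. A i)"
      using finite_Lim_measure_decseq[OF A(1,2)] .
    then have lim: "(\<lambda>i. 2 * B * measure M (A i)) \<longlonglongrightarrow> 0"
      using A(3) by (auto intro: tendsto_mult_right_zero)
    have "(\<lambda>i. \<nu> (A i)) \<longlonglongrightarrow> 0"
      by (rule tendsto_sandwich[OF _ _ tendsto_const lim])
        (use A(1) \<nu>_bounds in \<open>auto intro!: always_eventually\<close>)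
    then show "(\<lambda>i. ennreal (\<nu> (A i))) \<longlonglongrightarrow> 0"
      using tendsto_ennrealI by fastforce
  qed (use pos in auto)
  then have em_N: "emeasure N A = ennreal (\<nu> A)" if "A \<in> sets M" for A
    unfolding N_def using pos that by (intro emeasure_measure_of_sigma) (auto intro: sets.sigma_algebra_axioms)
  have fin_N: "finite_measure N"
    by (rule finite_measureI) (simp add: em_N space_N)
  have "absolutely_continuous M N"
    unfolding absolutely_continuous_def
  proof
    fix A assume "A \<in> null_sets M"
    then have "A \<in> sets M" "measure M A = 0"
      by (auto simp: null_sets_def measure_def)
    then show "A \<in> null_sets N"
      using \<nu>_bounds[of A] by (simp add: null_sets_def em_N ennreal_eq_0_iff)
  qed
  from Radon_Nikodym_finite_measure[OF fin_N sets_N this]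
  obtain f where f [measurable]: "f \<in> borel_measurable M" and Nf: "density M f = N"
    by blast
  define Y where "Y x = enn2real (f x)" for x
  have Y_meas [measurable]: "Y \<in> borel_measurable M"
    unfolding Y_def by measurable
  have "(\<integral>\<^sup>+x. f x \<partial>M) = emeasure N (space M)"
    by (simp add: Nf[symmetric] emeasure_density cong: nn_integral_cong)
  then have "(\<integral>\<^sup>+x. f x \<partial>M) \<noteq> \<infinity>"
    by (simp add: em_N)
  then have "AE x in M. f x \<noteq> \<infinity>"
    by (intro nn_integral_PInf_AE) auto
  then have "AE x in M. f x = ennreal (Y x)"
    by eventually_elim (auto simp: Y_def less_top)
  then have NY: "density M (\<lambda>x. ennreal (Y x)) = N"
    using Nf by (subst Nf[symmetric], intro density_cong) auto
  have Y_nonneg: "0 \<le> Y x" for x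
    by (simp add: Y_def)
  have Y_ind: "integrable M (\<lambda>x. Y x * indicator A x)" "(LINT x|M. Y x * indicator A x) = \<nu> A"
    if A: "A \<in> sets M" for A
  proof -
    have "integrable N (indicator A :: 'a \<Rightarrow> real)"
      using finite_measure.emeasure_finite[OF fin_N, of A] A
      by (auto simp: integrable_indicator_iff less_top space_N)
    then show "integrable M (\<lambda>x. Y x * indicator A x)"
      using integrable_density[of "indicator A :: 'a \<Rightarrow> real" M Y] A Y_nonneg
      by (simp add: NY)
    have "(LINT x|M. Y x * indicator A x) = (LINT x|N. indicator A x)"
      using integral_density[of "indicator A :: 'a \<Rightarrow> real" M Y] A Y_nonneg by (simp add: NY)
    also have "\<dots> = measure N A"
      using A sets.sets_into_space by (auto simp: space_N Int_absorb2)
    also have "\<dots> = \<nu> A"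
      using A \<nu>_bounds by (simp add: measure_def em_N)
    finally show "(LINT x|M. Y x * indicator A x) = \<nu> A" .
  qed
  have Y_le: "AE x in M. Y x \<le> 2 * B"
  proof -
    define A where "A = {x \<in> space M. 2 * B < Y x}"
    have A [measurable]: "A \<in> sets M" by (simp add: A_def)
    have int: "integrable M (\<lambda>x. Y x * indicator A x - 2 * B * indicator A x)"
      using Y_ind(1)[OF A] ind[OF A] by auto
    have "(LINT x|M. Y x * indicator A x - 2 * B * indicator A x) = \<nu> A - 2 * B * measure M A"
      using Y_ind[OF A] ind[OF A] A by (subst Bochner_Integration.integral_diff) auto
    then have le: "(LINT x|M. Y x * indicator A x - 2 * B * indicator A x) \<le> 0"
      using \<nu>_bounds(2)[OF A] by simp
    have nn: "0 \<le> Y x * indicator A x - 2 * B * indicator A x" for x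
      by (auto simp: A_def indicator_def)
    have "(LINT x|M. Y x * indicator A x - 2 * B * indicator A x) = 0"
      using le nn by (intro antisym integral_nonneg_AE) auto
    then have "AE x in M. Y x * indicator A x - 2 * B * indicator A x = 0"
      using integral_nonneg_eq_0_iff_AE[OF int] nn by auto
    then show ?thesis
      using AE_space by eventually_elim (auto simp: A_def indicator_def split: if_splits)
  qed
  define X where "X x = Y x - B" for x
  have X_meas [measurable]: "X \<in> borel_measurable M"
    unfolding X_def by measurable
  have X_le: "AE x in M. \<bar>X x\<bar> \<le> B"
    using Y_le
  proof eventually_elim
    case (elim x)
    then show ?case using Y_nonneg[of x] by (simp add: X_def)
  qed
  note X_int = integral_mult_AE_bounded[OF _ X_meas X_le]
  (* Both sides are linear and Lipschitz in the L1 norm, so agreement on indicators suffices. *)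
  have "(LINT x|M. X x * g x) = F g" if "integrable M g" for g
    using that
  proof (induction rule: integrable_induct)
    case (base A c)
    have "(LINT x|M. X x * indicator A x) = (LINT x|M. Y x * indicator A x - B * indicator A x)"
      by (simp add: X_def algebra_simps)
    also have "\<dots> = \<nu> A - B * measure M A"
      using Y_ind[OF base(1)] ind[OF base(1)] base by (subst Bochner_Integration.integral_diff) auto
    finally have "(LINT x|M. X x * indicator A x) = F (indicator A)"
      by (simp add: \<nu>_def)
    moreover have "(LINT x|M. X x * (indicator A x * c)) = c * (LINT x|M. X x * indicator A x)"
      by (subst Bochner_Integration.integral_mult_right_zero[symmetric]) (simp add: mult_ac)
    moreover have "F (\<lambda>x. indicator A x * c) = c * F (indicator A)"
      using scale[OF ind[OF base(1)], of c] by (simp add: mult.commute)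
    ultimately show ?case by simp
  next
    case (add f g)
    have "(LINT x|M. X x * (f x + g x)) = (LINT x|M. X x * f x) + (LINT x|M. X x * g x)"
      using X_int(1)[OF add.hyps(1)] X_int(1)[OF add.hyps(2)] by (simp add: distrib_left)
    then show ?case using add assms(1) by simp
  next
    case (lim f s)
    have [measurable]: "f \<in> borel_measurable M" "\<And>i. s i \<in> borel_measurable M"
      using lim by auto
    have int: "integrable M (\<lambda>x. s i x - f x)" for i using lim by auto
    have "(\<lambda>i. LINT x|M. \<bar>s i x - f x\<bar>) \<longlonglongrightarrow> (LINT x|M. 0)"
    proof (rule integral_dominated_convergence[where w="\<lambda>x. 3 * \<bar>f x\<bar>"])
      show "AE x in M. (\<lambda>i. \<bar>s i x - f x\<bar>) \<longlonglongrightarrow> 0"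
        using lim.hyps(2) by (intro AE_I2 tendsto_rabs_zero) (simp add: LIM_zero)
      show "AE x in M. norm \<bar>s i x - f x\<bar> \<le> 3 * \<bar>f x\<bar>" for i
      proof (rule AE_I2)
        fix x assume "x \<in> space M"
        then show "norm \<bar>s i x - f x\<bar> \<le> 3 * \<bar>f x\<bar>" using lim.hyps(3)[of x i] by simp
      qed
    qed (use lim in auto)
    then have L1: "(\<lambda>i. 2 * B * (LINT x|M. \<bar>s i x - f x\<bar>)) \<longlonglongrightarrow> 0"
      by (auto intro: tendsto_mult_right_zero)
    have "\<bar>(LINT x|M. X x * f x) - F f\<bar> \<le> 2 * B * (LINT x|M. \<bar>s i x - f x\<bar>)" for i
    proof -
      have "F (s i) = F (\<lambda>x. s i x - f x) + F f"
        using assms(1)[OF int lim.hyps(4), of i] by simp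
      moreover have "(LINT x|M. X x * s i x) = (LINT x|M. X x * (s i x - f x)) + (LINT x|M. X x * f x)"
        using X_int(1)[OF int, of i] X_int(1)[OF lim.hyps(4)]
        by (subst Bochner_Integration.integral_add[symmetric]) (auto simp: algebra_simps)
      ultimately show ?thesis
        using lim.IH[of i] bound[OF int, of i] X_int(2)[OF int, of i] by linarith
    qed
    then have "\<bar>(LINT x|M. X x * f x) - F f\<bar> \<le> 0"
      by (intro tendsto_lowerbound[OF L1]) (auto intro!: always_eventually)
    then show ?case by simp
  qed
  with X_meas X_le show ?thesis by (rule that)
qed

section \<open>Weak-star compactness of balls\<close>

text \<open>
  The product is indexed by all integrable functions \<open>g\<close>, with the interval \<open>[- B * \<parallel>g\<parallel>, B * \<parallel>g\<parallel>]\<close>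
  at \<open>g\<close>. Linearity is a family of closed conditions, each involving finitely many coordinates, so the
  linear functionals in the product form a compact set; the ball is its image under taking
  densities.
\<close>

lemma compactin_weak_star_ball:
  assumes "0 \<le> B"
  shows "compactin (Linf_weak_star M)
    {ae_class M X | X. X \<in> borel_measurable M \<and> (AE x in M. \<bar>X x\<bar> \<le> B)}" (is "compactin _ ?ball")
proof -
  define I where "I = {g :: 'a \<Rightarrow> real. integrable M g}"
  define T where "T = product_topology (\<lambda>_. euclideanreal) I"
  define b where "b g = B * (LINT x|M. \<bar>g x\<bar>)" for g
  define P where "P = (\<Pi>\<^sub>E g\<in>I. {- b g..b g})"
  define L where "L = {F \<in> topspace T.
      (\<forall>f\<in>I. \<forall>g\<in>I. F (\<lambda>x. f x + g x) - (F f + F g) \<in> {0}) \<and>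
      (\<forall>c. \<forall>f\<in>I. F (\<lambda>x. c * f x) - c * F f \<in> {0})}"
  have P_compact: "compactin T P"
    unfolding T_def P_def by (simp add: compactin_PiE)
  have proj: "continuous_map T euclideanreal (\<lambda>F. F g)" if "g \<in> I" for g
    unfolding T_def using that continuous_map_product_projection[of g I "\<lambda>_. euclideanreal"] by simp
  have I_add: "(\<lambda>x. f x + g x) \<in> I" if "f \<in> I" "g \<in> I" for f g
    using that by (simp add: I_def)
  have I_scale: "(\<lambda>x. c * f x) \<in> I" if "f \<in> I" for c f
    using that by (simp add: I_def)
  have zero_I: "(\<lambda>x. 0) \<in> I" by (simp add: I_def)
  have "closedin T {F \<in> topspace T. F (\<lambda>x. f x + g x) - (F f + F g) \<in> {0}}"
    if "f \<in> I" "g \<in> I" for f g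
    by (rule closedin_continuous_map_preimage[where Y=euclideanreal])
      (auto intro!: continuous_map_diff continuous_map_add proj that I_add)
  moreover have "closedin T {F \<in> topspace T. F (\<lambda>x. c * f x) - c * F f \<in> {0}}"
    if "f \<in> I" for c f
    by (rule closedin_continuous_map_preimage[where Y=euclideanreal])
      (auto intro!: continuous_map_diff continuous_map_real_mult_left proj that I_scale)
  ultimately have "closedin T ((\<Inter>f\<in>I. \<Inter>g\<in>I. {F \<in> topspace T. F (\<lambda>x. f x + g x) - (F f + F g) \<in> {0}})
      \<inter> (\<Inter>c. \<Inter>f\<in>I. {F \<in> topspace T. F (\<lambda>x. c * f x) - c * F f \<in> {0}}))"
    using zero_I by (intro closedin_Int closedin_INT) auto
  also have "\<dots> = L"
    using zero_I by (auto simp: L_def)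
  finally have compact: "compactin T (P \<inter> L)"
    using P_compact by (rule compact_Int_closedin[rotated])
  (* R inverts the embedding of the ball into the product space: it picks a density of the
     functional F. *)
  define R where "R F = (SOME X. X \<in> borel_measurable M \<and> (AE x in M. \<bar>X x\<bar> \<le> B) \<and>
      (\<forall>g\<in>I. (LINT x|M. X x * g x) = F g))" for F
  have R: "R F \<in> borel_measurable M" "AE x in M. \<bar>R F x\<bar> \<le> B"
      "\<And>g. g \<in> I \<Longrightarrow> (LINT x|M. R F x * g x) = F g" if F: "F \<in> P \<inter> L" for F
  proof -
    have add: "F (\<lambda>x. f x + g x) = F f + F g" if "integrable M f" "integrable M g" for f g
      using F that by (auto simp: L_def I_def)
    have scale: "F (\<lambda>x. c * f x) = c * F f" if "integrable M f" for c f
      using F that by (auto simp: L_def I_def)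
    have bound: "\<bar>F f\<bar> \<le> B * (LINT x|M. \<bar>f x\<bar>)" if "integrable M f" for f
    proof -
      have "F f \<in> {- b f..b f}"
        using F that PiE_mem[of F I "\<lambda>g. {- b g..b g}" f] by (simp add: P_def I_def)
      then show ?thesis by (simp add: b_def abs_le_iff minus_le_iff)
    qed
    obtain X where "X \<in> borel_measurable M" "AE x in M. \<bar>X x\<bar> \<le> B"
        "\<And>f. integrable M f \<Longrightarrow> (LINT x|M. X x * f x) = F f"
      by (rule L1_dual_bounded_density[OF add scale bound \<open>0 \<le> B\<close>]) blast+
    then have "\<exists>X. X \<in> borel_measurable M \<and> (AE x in M. \<bar>X x\<bar> \<le> B) \<and>
        (\<forall>g\<in>I. (LINT x|M. X x * g x) = F g)"
      by (auto simp: I_def)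
    from someI_ex[OF this]
    show "R F \<in> borel_measurable M" "AE x in M. \<bar>R F x\<bar> \<le> B"
      "\<And>g. g \<in> I \<Longrightarrow> (LINT x|M. R F x * g x) = F g"
      unfolding R_def by auto
  qed
  have R_ess: "R F \<in> ess_bounded M" if "F \<in> P \<inter> L" for F
    using R[OF that] by (intro ess_boundedI)
  have top: "topspace (subtopology T (P \<inter> L)) = P \<inter> L"
    by (auto simp: L_def)
  have "continuous_map (subtopology T (P \<inter> L)) (Linf_weak_star M) (\<lambda>F. ae_class M (R F))"
    unfolding Linf_weak_star_def
  proof (rule continuous_on_generated_topo)
    fix U assume "U \<in> {Linf_preimage M g U | g U. integrable M g \<and> open U}"
    then obtain g V where U: "U = Linf_preimage M g V" and g: "integrable M g" and V: "open V"
      by blast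
    have "(\<lambda>F. ae_class M (R F)) -` U \<inter> topspace (subtopology T (P \<inter> L))
        = {F \<in> topspace (subtopology T (P \<inter> L)). F g \<in> V}"
      unfolding top U using ae_class_in_Linf_preimage_iff[OF R_ess g] R(3) g
      by (auto simp: I_def)
    also have "openin (subtopology T (P \<inter> L)) \<dots>"
      using g V
      by (intro openin_continuous_map_preimage[where Y=euclideanreal] continuous_map_from_subtopology proj)
        (auto simp: I_def)
    finally show "openin (subtopology T (P \<inter> L))
      ((\<lambda>F. ae_class M (R F)) -` U \<inter> topspace (subtopology T (P \<inter> L)))" .
  next
    have "\<Union> {Linf_preimage M g U | g U. integrable M g \<and> open U} = Linf M"
      using topspace_Linf_weak_star[of M]
      unfolding Linf_weak_star_def topology_generated_by_topspace .
    then show "(\<lambda>F. ae_class M (R F)) ` topspace (subtopology T (P \<inter> L))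
      \<subseteq> \<Union> {Linf_preimage M g U | g U. integrable M g \<and> open U}"
      unfolding top using R_ess by (auto simp: Linf_def)
  qed
  then have "compactin (Linf_weak_star M) ((\<lambda>F. ae_class M (R F)) ` (P \<inter> L))"
    using compact by (intro image_compactin[of "subtopology T (P \<inter> L)"]) (auto simp: compactin_subtopology)
  also have "(\<lambda>F. ae_class M (R F)) ` (P \<inter> L) = ?ball"
  proof (intro antisym subsetI)
    fix Z assume "Z \<in> (\<lambda>F. ae_class M (R F)) ` (P \<inter> L)"
    then show "Z \<in> ?ball" using R by blast
  next
    fix Z assume "Z \<in> ?ball"
    then obtain X where Z: "Z = ae_class M X" and X: "X \<in> borel_measurable M" "AE x in M. \<bar>X x\<bar> \<le> B"
      by blast
    note [measurable] = X(1)
    have int: "integrable M (\<lambda>x. X x * g x)" and le: "\<bar>LINT x|M. X x * g x\<bar> \<le> b g" if "g \<in> I" for g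
      using integral_mult_AE_bounded[OF _ X, of g] that by (auto simp: I_def b_def)
    define F where "F = restrict (\<lambda>g. LINT x|M. X x * g x) I"
    have "F \<in> P"
      using le by (auto simp: F_def P_def abs_le_iff minus_le_iff)
    moreover have "F \<in> L"
      using int I_add I_scale
      by (auto simp: F_def L_def T_def distrib_left mult.left_commute)
    ultimately have F: "F \<in> P \<inter> L" ..
    have X_ess: "X \<in> ess_bounded M"
      using X by (rule ess_boundedI)
    (* The density chosen for F need not be X itself, only an element of its class. *)
    have "AE x in M. R F x = X x"
    proof (rule density_unique_real)
      show "integrable M (R F)" "integrable M X"
        using R_ess[OF F] X_ess by (auto intro: integrable_ess_bounded)
      fix A assume A: "A \<in> sets M"
      have ind: "indicator A \<in> I"
        using A by (auto simp: I_def less_top[symmetric] intro!: integrable_real_indicator)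
      show "(LINT x:A|M. R F x) = (LINT x:A|M. X x)"
        using R(3)[OF F ind] ind by (simp add: F_def set_lebesgue_integral_def mult.commute)
    qed
    then have "ae_class M (R F) = Z"
      unfolding Z using ae_class_eq_iff[OF R(1)[OF F]] by simp
    then show "Z \<in> (\<lambda>F. ae_class M (R F)) ` (P \<inter> L)"
      using F by blast
  qed
  finally show ?thesis .
qed

end

section \<open>Convex sets closed under almost-everywhere limits\<close>

definition convex_functions :: "('a \<Rightarrow> real) set \<Rightarrow> bool" where
  "convex_functions S \<longleftrightarrow>
     (\<forall>f\<in>S. \<forall>g\<in>S. \<forall>t\<in>{0..1::real}. (\<lambda>x. t * f x + (1 - t) * g x) \<in> S)"

text \<open>
  A set of measurable functions with this property is a union of almost-everywhere equivalence
  classes: if \<open>f\<close> is in the set and \<open>g = f\<close> almost everywhere, then the constant sequence \<open>f\<close>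
  converges to \<open>g\<close> almost everywhere. Restricting the limits to sequences suits both the Fatou
  property and the construction of nearest points.
\<close>

definition ae_closed :: "'a measure \<Rightarrow> ('a \<Rightarrow> real) set \<Rightarrow> bool" where
  "ae_closed M S \<longleftrightarrow>
     (\<forall>(u :: nat \<Rightarrow> 'a \<Rightarrow> real) f. (\<forall>n. u n \<in> S) \<and> f \<in> borel_measurable M \<and>
        (AE x in M. (\<lambda>n. u n x) \<longlonglongrightarrow> f x) \<longrightarrow> f \<in> S)"

lemma convex_functionsD:
  "convex_functions S \<Longrightarrow> f \<in> S \<Longrightarrow> g \<in> S \<Longrightarrow> t \<in> {0..1} \<Longrightarrow> (\<lambda>x. t * f x + (1 - t) * g x) \<in> S"
  by (simp add: convex_functions_def)

lemma ae_closedD: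
  "ae_closed M S \<Longrightarrow> (\<And>n. u n \<in> S) \<Longrightarrow> f \<in> borel_measurable M \<Longrightarrow>
    AE x in M. (\<lambda>n. u n x) \<longlonglongrightarrow> f x \<Longrightarrow> f \<in> S"
  unfolding ae_closed_def by blast

text \<open>
  The total variation of the sequence has a finite integral, so it is finite almost everywhere.
\<close>

lemma AE_convergent_if_summable_L1:
  fixes u :: "nat \<Rightarrow> 'a \<Rightarrow> real"
  assumes int: "\<And>n. integrable M (u n)"
    and sum: "summable (\<lambda>n. LINT x|M. \<bar>u (Suc n) x - u n x\<bar>)"
  shows "AE x in M. convergent (\<lambda>n. u n x)"
proof -
  have meas [measurable]: "u n \<in> borel_measurable M" for n using int by auto
  have "(\<integral>\<^sup>+x. (\<Sum>n. ennreal \<bar>u (Suc n) x - u n x\<bar>) \<partial>M)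
      = (\<Sum>n. \<integral>\<^sup>+x. ennreal \<bar>u (Suc n) x - u n x\<bar> \<partial>M)"
    by (rule nn_integral_suminf) auto
  also have "\<dots> = (\<Sum>n. ennreal (LINT x|M. \<bar>u (Suc n) x - u n x\<bar>))"
    using int by (intro suminf_cong nn_integral_eq_integral) auto
  also have "\<dots> = ennreal (\<Sum>n. LINT x|M. \<bar>u (Suc n) x - u n x\<bar>)"
    using sum by (intro suminf_ennreal2) auto
  finally have "(\<integral>\<^sup>+x. (\<Sum>n. ennreal \<bar>u (Suc n) x - u n x\<bar>) \<partial>M) \<noteq> \<infinity>"
    by simp
  then have "AE x in M. (\<Sum>n. ennreal \<bar>u (Suc n) x - u n x\<bar>) \<noteq> \<infinity>"
    by (intro nn_integral_PInf_AE) auto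
  then show ?thesis
  proof eventually_elim
    case (elim x)
    then have "summable (\<lambda>n. \<bar>u (Suc n) x - u n x\<bar>)"
      by (intro summable_suminf_not_top) auto
    then have "summable (\<lambda>n. u (Suc n) x - u n x)"
      by (rule summable_rabs_cancel)
    then have "convergent (\<lambda>n. \<Sum>k<n. u (Suc k) x - u k x)"
      by (simp add: summable_iff_convergent)
    then have "convergent (\<lambda>n. u n x - u 0 x)"
      using sum_lessThan_telescope[of "\<lambda>n. u n x"] by simp
    from convergent_add[OF this convergent_const[of "u 0 x"]] show ?case
      by simp
  qed
qed

context finite_measure
begin

text \<open>
  A minimizing sequence is Cauchy in \<open>L\<^sup>2\<close> by the parallelogram law. The sequence is chosen to
  minimize at a geometric rate, so that it converges almost everywhere without passing to a
  subsequence, and the closure hypothesis applies to its limit.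
\<close>

lemma convex_set_L2_projection:
  fixes S :: "('a \<Rightarrow> real) set"
  assumes "S \<noteq> {}"
    and meas: "S \<subseteq> borel_measurable M"
    and bdd: "\<forall>f\<in>S. AE x in M. \<bar>f x\<bar> \<le> B"
    and convex: "convex_functions S"
    and closed: "ae_closed M S"
    and h: "h \<in> ess_bounded M"
  obtains p where "p \<in> S" "\<And>f. f \<in> S \<Longrightarrow> (LINT x|M. (p x - h x)\<^sup>2) \<le> (LINT x|M. (f x - h x)\<^sup>2)"
proof -
  have S_ess: "f \<in> ess_bounded M" if "f \<in> S" for f
    using meas bdd that by (auto intro: ess_boundedI)
  define q where "q f = (LINT x|M. (f x - h x)\<^sup>2)" for f
  have q_nonneg: "0 \<le> q f" for f
    by (simp add: q_def)
  define d where "d = (INF f\<in>S. q f)"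
  have bddb: "bdd_below (q ` S)"
    using q_nonneg by (intro bdd_belowI2[where m=0])
  have d_le: "d \<le> q f" if "f \<in> S" for f
    using that bddb by (auto simp: d_def intro: cINF_lower)
  have "\<exists>f\<in>S. q f < d + (1/4) ^ n" for n
    using cINF_less_iff[OF \<open>S \<noteq> {}\<close> bddb, of "d + (1/4) ^ n"] by (simp add: d_def)
  then obtain u where u: "\<And>n. u n \<in> S" "\<And>n. q (u n) < d + (1/4) ^ n"
    by metis
  have u_ess: "u n \<in> ess_bounded M" for n using S_ess u(1) by blast
  have [measurable]: "u n \<in> borel_measurable M" for n using u_ess by (rule ess_bounded_measurable)
  have [measurable]: "h \<in> borel_measurable M" using h by (rule ess_bounded_measurable)
  (* Parallelogram law for u (Suc n) - h and u n - h; their midpoint is again in S, so it is at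
     distance at least d. *)
  have L2: "(LINT x|M. (u (Suc n) x - u n x)\<^sup>2) \<le> 4 * (1/4) ^ n" for n
  proof -
    let ?a = "u (Suc n)" and ?b = "u n"
    let ?m = "\<lambda>x. 1/2 * ?a x + (1 - 1/2) * ?b x"
    have m: "?m \<in> S" using convex_functionsD[OF convex u(1) u(1), of "1/2"] by simp
    have "(LINT x|M. (?a x - ?b x)\<^sup>2)
        = (LINT x|M. (2 * (?a x - h x)\<^sup>2 + 2 * (?b x - h x)\<^sup>2) - 4 * (?m x - h x)\<^sup>2)"
      by (intro Bochner_Integration.integral_cong) (auto simp: power2_eq_square field_simps)
    also have "\<dots> = 2 * q ?a + 2 * q ?b - 4 * q ?m"
    proof -
      have "integrable M (\<lambda>x. (f x - h x)\<^sup>2)" if "f \<in> S" for f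
        by (intro integrable_ess_bounded ess_bounded_power2 ess_bounded_diff S_ess that h)
      from this[OF u(1)] this[OF m] show ?thesis
        unfolding q_def
        by (subst Bochner_Integration.integral_diff, simp, simp,
            subst Bochner_Integration.integral_add) auto
    qed
    also have "\<dots> \<le> 4 * (1/4) ^ n"
    proof -
      have "(1/4::real) ^ Suc n \<le> (1/4) ^ n" by simp
      then show ?thesis using u(2)[of n] u(2)[of "Suc n"] d_le[OF m] by linarith
    qed
    finally show ?thesis .
  qed
  have L1: "(LINT x|M. \<bar>u (Suc n) x - u n x\<bar>) \<le> (2 + measure M (space M) / 2) * (1/2) ^ n" for n
  proof -
    have int: "integrable M (\<lambda>x. (u (Suc n) x - u n x)\<^sup>2)" "integrable M (\<lambda>x. u (Suc n) x - u n x)"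
      using u_ess by (auto intro!: integrable_ess_bounded ess_bounded_intros)
    (* Young's inequality with weight 2^n, in place of Cauchy-Schwarz: with this weight both
       the squared term, by L2, and the constant term decay like (1/2)^n. *)
    have young: "\<bar>s\<bar> \<le> 2 ^ n / 2 * s\<^sup>2 + (1/2) ^ n / 2" for s :: real
    proof -
      have "0 \<le> (2 ^ n * \<bar>s\<bar> - 1)\<^sup>2" by simp
      then have "2 * 2 ^ n * \<bar>s\<bar> \<le> 2 ^ n * 2 ^ n * s\<^sup>2 + 1"
        by (simp add: power2_eq_square algebra_simps)
      then show ?thesis by (simp add: field_simps power_one_over)
    qed
    have "(LINT x|M. \<bar>u (Suc n) x - u n x\<bar>)
        \<le> (LINT x|M. 2 ^ n / 2 * (u (Suc n) x - u n x)\<^sup>2 + (1/2) ^ n / 2)"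
      using int young by (intro integral_mono) auto
    also have "\<dots> = 2 ^ n / 2 * (LINT x|M. (u (Suc n) x - u n x)\<^sup>2) + (1/2) ^ n / 2 * measure M (space M)"
      using int by (subst Bochner_Integration.integral_add) auto
    also have "\<dots> \<le> 2 ^ n / 2 * (4 * (1/4) ^ n) + (1/2) ^ n / 2 * measure M (space M)"
      using L2[of n] by (intro add_right_mono mult_left_mono) auto
    also have "2 ^ n / 2 * (4 * (1/4) ^ n) = 2 * (1/2::real) ^ n"
    proof -
      have "(2::real) ^ n * (1/4) ^ n = (1/2) ^ n"
        by (subst power_mult_distrib[symmetric]) simp
      then show ?thesis by simp
    qed
    finally show ?thesis by (simp add: algebra_simps)
  qed
  have "summable (\<lambda>n. LINT x|M. \<bar>u (Suc n) x - u n x\<bar>)"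
  proof (rule summable_comparison_test'[where N=0])
    show "summable (\<lambda>n. (2 + measure M (space M) / 2) * (1/2::real) ^ n)"
      by (rule summable_mult) (simp add: summable_geometric)
  qed (use L1 in simp)
  then have conv: "AE x in M. convergent (\<lambda>n. u n x)"
    using u_ess by (intro AE_convergent_if_summable_L1 integrable_ess_bounded)
  define p where "p x = lim (\<lambda>n. u n x)" for x
  have [measurable]: "p \<in> borel_measurable M" unfolding p_def by measurable
  have lim: "AE x in M. (\<lambda>n. u n x) \<longlonglongrightarrow> p x"
    using conv by eventually_elim (simp add: p_def convergent_LIMSEQ_iff)
  have "p \<in> S" using ae_closedD[OF closed u(1) _ lim] by simp
  obtain H where H: "AE x in M. \<bar>h x\<bar> \<le> H" using h by (auto simp: ess_bounded_def)
  have "(\<lambda>n. q (u n)) \<longlonglongrightarrow> q p"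
    unfolding q_def
  proof (rule integral_dominated_convergence[where w="\<lambda>x. (B + H)\<^sup>2"])
    show "AE x in M. (\<lambda>n. (u n x - h x)\<^sup>2) \<longlonglongrightarrow> (p x - h x)\<^sup>2"
      using lim by eventually_elim (intro tendsto_power tendsto_diff tendsto_const)
    show "AE x in M. norm ((u n x - h x)\<^sup>2) \<le> (B + H)\<^sup>2" for n
      using bdd[rule_format, OF u(1)[of n]] H
    proof eventually_elim
      case (elim x)
      then have "\<bar>u n x - h x\<bar> \<le> \<bar>B + H\<bar>" by linarith
      then show ?case by (simp add: abs_le_square_iff)
    qed
  qed auto
  moreover have "(\<lambda>n. d + (1/4) ^ n) \<longlonglongrightarrow> d + 0"
    by (intro tendsto_intros LIMSEQ_power_zero) simp
  ultimately have "q p \<le> d + 0"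
    using u(2) by (intro LIMSEQ_le[of "\<lambda>n. q (u n)" _ "\<lambda>n. d + (1/4) ^ n"]) (auto intro: less_imp_le)
  with d_le have "q p \<le> q f" if "f \<in> S" for f using that by fastforce
  with \<open>p \<in> S\<close> show ?thesis by (intro that) (auto simp: q_def)
qed

text \<open>
  With \<open>p\<close> the nearest point to \<open>h\<close>, minimality rules out an acute angle at \<open>p\<close> between \<open>h - p\<close>
  and \<open>f - p\<close> for every \<open>f\<close> in \<open>S\<close>, so integration against \<open>g = h - p\<close> is maximal on \<open>S\<close> at \<open>p\<close>.
  Its value at \<open>h\<close> is larger by the squared distance, which is positive because \<open>S\<close> contains every
  measurable function almost everywhere equal to \<open>p\<close>.
\<close>

lemma convex_set_separation:
  fixes S :: "('a \<Rightarrow> real) set"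
  assumes "S \<noteq> {}"
    and meas: "S \<subseteq> borel_measurable M"
    and bdd: "\<forall>f\<in>S. AE x in M. \<bar>f x\<bar> \<le> B"
    and convex: "convex_functions S"
    and closed: "ae_closed M S"
    and h: "h \<in> ess_bounded M" "h \<notin> S"
  obtains g c where "integrable M g" "\<And>f. f \<in> S \<Longrightarrow> (LINT x|M. f x * g x) \<le> c"
    "c < (LINT x|M. h x * g x)"
proof -
  obtain p where p: "p \<in> S"
    and min: "\<And>f. f \<in> S \<Longrightarrow> (LINT x|M. (p x - h x)\<^sup>2) \<le> (LINT x|M. (f x - h x)\<^sup>2)"
    by (rule convex_set_L2_projection[OF assms(1-5) h(1)]) blast
  have S_ess: "f \<in> ess_bounded M" if "f \<in> S" for f
    using meas bdd that by (auto intro: ess_boundedI)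
  (* The separating functional is integration against the outward normal at the nearest point. *)
  define g where "g x = h x - p x" for x
  have g: "g \<in> ess_bounded M"
    unfolding g_def using h S_ess[OF p] by (intro ess_bounded_intros)
  have "(LINT x|M. f x * g x) \<le> (LINT x|M. p x * g x)" if f: "f \<in> S" for f
  proof -
    define D where "D = (LINT x|M. (f x - p x)\<^sup>2)"
    define A where "A = (LINT x|M. (f x - p x) * g x)"
    have diff: "(\<lambda>x. f x - p x) \<in> ess_bounded M"
      using S_ess f p by (intro ess_bounded_intros) auto
    have "0 \<le> D" by (simp add: D_def)
    (* First variation of the squared distance at p in the direction f - p, divided by t. *)
    have quad: "2 * A \<le> t * D" if t: "0 < t" "t \<le> 1" for t
    proof -
      have "(\<lambda>x. t * f x + (1 - t) * p x) \<in> S"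
        using convex_functionsD[OF convex f p] t by simp
      from min[OF this]
      have "(LINT x|M. (g x)\<^sup>2) \<le> (LINT x|M. (t * f x + (1 - t) * p x - h x)\<^sup>2)"
        by (simp add: g_def power2_commute)
      also have "\<dots> = (LINT x|M. ((g x)\<^sup>2 - (2 * t) * ((f x - p x) * g x)) + t\<^sup>2 * (f x - p x)\<^sup>2)"
        by (intro Bochner_Integration.integral_cong) (auto simp: g_def power2_eq_square algebra_simps)
      also have "\<dots> = (LINT x|M. (g x)\<^sup>2) - 2 * t * A + t\<^sup>2 * D"
      proof -
        have "integrable M (\<lambda>x. (g x)\<^sup>2)" "integrable M (\<lambda>x. (f x - p x) * g x)"
          "integrable M (\<lambda>x. (f x - p x)\<^sup>2)"
          by (intro integrable_ess_bounded ess_bounded_power2 ess_bounded_mult g diff)+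
        then show ?thesis by (simp add: A_def D_def)
      qed
      finally have "t * (2 * A) \<le> t * (t * D)" by (simp add: power2_eq_square)
      then show ?thesis using t by (simp add: mult_le_cancel_left_pos)
    qed
    have "((\<lambda>t. t * D) \<longlongrightarrow> 0 * D) (at_right 0)"
      by (intro tendsto_intros)
    moreover have "eventually (\<lambda>t. 2 * A \<le> t * D) (at_right (0::real))"
      using eventually_at_right_less[of 0] eventually_at_right_real[of 0 1]
      by (auto elim!: eventually_mono intro: quad)
    ultimately have "2 * A \<le> 0 * D"
      by (intro tendsto_lowerbound) auto
    then have "A \<le> 0" by simp
    moreover have "A = (LINT x|M. f x * g x) - (LINT x|M. p x * g x)"
    proof -
      have "integrable M (\<lambda>x. f x * g x)" "integrable M (\<lambda>x. p x * g x)"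
        using S_ess f p g by (auto intro!: integrable_ess_bounded ess_bounded_mult)
      then show ?thesis by (simp add: A_def left_diff_distrib)
    qed
    ultimately show ?thesis by simp
  qed
  moreover have "(LINT x|M. p x * g x) < (LINT x|M. h x * g x)"
  proof -
    have int: "integrable M (\<lambda>x. h x * g x)" "integrable M (\<lambda>x. p x * g x)" "integrable M (\<lambda>x. (g x)\<^sup>2)"
      using S_ess p g h by (auto intro!: integrable_ess_bounded ess_bounded_mult ess_bounded_power2)
    have "(LINT x|M. (g x)\<^sup>2) \<noteq> 0"
    proof
      assume "(LINT x|M. (g x)\<^sup>2) = 0"
      then have "AE x in M. (g x)\<^sup>2 = 0"
        using integral_nonneg_eq_0_iff_AE[OF int(3)] by simp
      then have "AE x in M. (\<lambda>n::nat. p x) \<longlonglongrightarrow> h x"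
        by eventually_elim (simp add: g_def)
      then have "h \<in> S"
        using ae_closedD[OF closed, of "\<lambda>_. p" h] p h(1) by (auto dest: ess_bounded_measurable)
      with h(2) show False ..
    qed
    then have "0 < (LINT x|M. (g x)\<^sup>2)"
      by (simp add: order.not_eq_order_implies_strict)
    also have "\<dots> = (LINT x|M. h x * g x - p x * g x)"
      by (intro Bochner_Integration.integral_cong) (auto simp: g_def power2_eq_square algebra_simps)
    also have "\<dots> = (LINT x|M. h x * g x) - (LINT x|M. p x * g x)"
      using int by simp
    finally show ?thesis by simp
  qed
  ultimately show ?thesis
    using integrable_ess_bounded[OF g] by (intro that)
qed

text \<open>
  Every class outside \<open>S\<close> has a subbasic neighbourhood disjoint from \<open>S\<close>, an open half space
  provided by separation.
\<close>

lemma closedin_weak_star_if_ae_closed: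
  assumes meas: "S \<subseteq> borel_measurable M"
    and bdd: "\<forall>f\<in>S. AE x in M. \<bar>f x\<bar> \<le> B"
    and convex: "convex_functions S"
    and closed: "ae_closed M S"
  shows "closedin (Linf_weak_star M) (ae_class M ` S)"
proof (cases "S = {}")
  case False
  have S_ess: "f \<in> ess_bounded M" if "f \<in> S" for f
    using meas bdd that by (auto intro: ess_boundedI)
  have "\<exists>U. openin (Linf_weak_star M) U \<and> Z \<in> U \<and> U \<subseteq> Linf M - ae_class M ` S"
    if Z_in: "Z \<in> Linf M - ae_class M ` S" for Z
  proof -
    obtain h where Z: "Z = ae_class M h" and h: "h \<in> ess_bounded M" "h \<notin> S"
      using Z_in unfolding Linf_def by blast
    obtain g c where g: "integrable M g" and le: "\<And>f. f \<in> S \<Longrightarrow> (LINT x|M. f x * g x) \<le> c"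
      and gt: "c < (LINT x|M. h x * g x)"
      by (rule convex_set_separation[OF False assms h]) blast
    let ?U = "Linf_preimage M g {c<..}"
    have "openin (Linf_weak_star M) ?U"
      unfolding Linf_weak_star_def using g open_greaterThan by (intro topology_generated_by_Basis) blast
    moreover have "Z \<in> ?U"
      using gt by (simp add: Z ae_class_in_Linf_preimage_iff[OF h(1) g])
    moreover have "?U \<subseteq> Linf M"
      by (auto simp: Linf_preimage_def Linf_def)
    moreover have "ae_class M f \<notin> ?U" if "f \<in> S" for f
      using le[OF that] by (simp add: ae_class_in_Linf_preimage_iff[OF S_ess[OF that] g])
    ultimately show ?thesis by blast
  qed
  then have "openin (Linf_weak_star M) (Linf M - ae_class M ` S)"
    by (subst openin_subopen) blast
  then show ?thesis
    using S_ess by (auto simp: closedin_def topspace_Linf_weak_star Linf_def)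
qed simp

end

section \<open>The Fatou property of convex expectations\<close>

lemma convex_expectation_mono:
  "convex_expectation M \<rho> \<Longrightarrow> X \<in> ess_bounded M \<Longrightarrow> Y \<in> ess_bounded M \<Longrightarrow>
    AE x in M. X x \<le> Y x \<Longrightarrow> \<rho> (ae_class M X) \<le> \<rho> (ae_class M Y)"
  by (simp add: convex_expectation_def)

lemma convex_expectation_convex:
  "convex_expectation M \<rho> \<Longrightarrow> X \<in> ess_bounded M \<Longrightarrow> Y \<in> ess_bounded M \<Longrightarrow> t \<in> {0..1} \<Longrightarrow>
    \<rho> (ae_class M (\<lambda>x. t * X x + (1 - t) * Y x))
      \<le> t * \<rho> (ae_class M X) + (1 - t) * \<rho> (ae_class M Y)"
  by (simp add: convex_expectation_def)

lemma INF_tail_LIMSEQ: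
  fixes a :: "nat \<Rightarrow> real"
  assumes "a \<longlonglongrightarrow> l"
  shows "(\<lambda>n. INF m\<in>{n..}. a m) \<longlonglongrightarrow> l"
proof (rule LIMSEQ_I)
  have bdd: "bdd_below (a ` {n..})" for n
    using Bseq_bdd_below[OF convergent_imp_Bseq[OF convergentI[OF assms]]]
    by (rule bdd_below_mono) auto
  fix e :: real assume "0 < e"
  then obtain N where N: "\<And>n. n \<ge> N \<Longrightarrow> \<bar>a n - l\<bar> < e / 2"
    using LIMSEQ_D[OF assms, of "e / 2"] by auto
  have "norm ((INF m\<in>{n..}. a m) - l) < e" if "n \<ge> N" for n
  proof -
    have "(INF m\<in>{n..}. a m) \<le> a n"
      using bdd by (intro cINF_lower) auto
    moreover have "l - e / 2 \<le> (INF m\<in>{n..}. a m)"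
    proof (rule cINF_greatest)
      fix m assume "m \<in> {n..}"
      with that have "\<bar>a m - l\<bar> < e / 2" by (intro N) simp
      then show "l - e / 2 \<le> a m" by linarith
    qed auto
    ultimately show ?thesis
      using N[OF that] \<open>0 < e\<close> unfolding real_norm_def by linarith
  qed
  then show "\<exists>N. \<forall>n\<ge>N. norm ((INF m\<in>{n..}. a m) - l) < e" by blast
qed

text \<open>
  This is sequential lower semicontinuity along bounded almost-everywhere convergent sequences: continuity
  along increasing sequences extends to it through tail infima.
\<close>

lemma convex_expectation_Fatou:
  assumes \<rho>: "convex_expectation M \<rho>" and cont: "continuous_from_below M \<rho>"
    and meas: "\<And>n. X n \<in> borel_measurable M" "Y \<in> borel_measurable M"
    and bdd: "\<And>n. AE x in M. \<bar>X n x\<bar> \<le> B"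
    and lim: "AE x in M. (\<lambda>n. X n x) \<longlonglongrightarrow> Y x"
    and le: "\<And>n::nat. \<rho> (ae_class M (X n)) \<le> \<alpha>"
  shows "\<rho> (ae_class M Y) \<le> \<alpha>"
proof -
  note [measurable] = meas
  (* The tail infima increase to Y and lie below X n, so monotonicity bounds their values by \<alpha>. *)
  define Z where "Z n x = (INF m\<in>{n..}. X m x)" for n x
  have Z_meas [measurable]: "Z n \<in> borel_measurable M" for n
    unfolding Z_def by measurable
  have bdd': "AE x in M. \<forall>n. \<bar>X n x\<bar> \<le> B"
    using bdd by (simp add: AE_all_countable)
  have Z_props: "AE x in M. \<bar>Z n x\<bar> \<le> B \<and> Z n x \<le> X n x \<and> Z n x \<le> Z (Suc n) x" for n
    using bdd'
  proof eventually_elim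
    case (elim x)
    have bb: "bdd_below ((\<lambda>m. X m x) ` {k..})" for k
      using elim by (intro bdd_belowI2[where m="- B"]) (simp add: abs_le_iff minus_le_iff)
    have "- B \<le> Z n x"
      unfolding Z_def using elim by (intro cINF_greatest) (auto simp: abs_le_iff minus_le_iff)
    moreover have "Z n x \<le> X n x"
      unfolding Z_def using bb by (intro cINF_lower) auto
    moreover have "Z n x \<le> Z (Suc n) x"
      unfolding Z_def using bb by (intro cINF_superset_mono) auto
    ultimately show ?case
      using elim by (smt (verit, best))
  qed
  have X_ess: "X n \<in> ess_bounded M" for n
    using bdd by (intro ess_boundedI) auto
  have Z_ess: "Z n \<in> ess_bounded M" for n
    using Z_props[of n] by (intro ess_boundedI[where C=B]) auto
  have Y_ess: "Y \<in> ess_bounded M"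
  proof (rule ess_boundedI)
    show "AE x in M. \<bar>Y x\<bar> \<le> B"
      using bdd' lim
    proof eventually_elim
      case (elim x)
      then show ?case by (intro tendsto_upperbound[OF tendsto_rabs[OF elim(2)]]) auto
    qed
  qed (rule meas)
  have "AE x in M. (\<lambda>n. Z n x) \<longlonglongrightarrow> Y x"
    using lim by eventually_elim (simp add: Z_def INF_tail_LIMSEQ)
  moreover have "AE x in M. Z n x \<le> Z (Suc n) x" for n
    using Z_props[of n] by eventually_elim simp
  ultimately have "(\<lambda>n. \<rho> (ae_class M (Z n))) \<longlonglongrightarrow> \<rho> (ae_class M Y)"
    using cont Z_ess Y_ess unfolding continuous_from_below_def by blast
  moreover have "\<rho> (ae_class M (Z n)) \<le> \<alpha>" for n
  proof -
    have "AE x in M. Z n x \<le> X n x"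
      using Z_props[of n] by eventually_elim simp
    from convex_expectation_mono[OF \<rho> Z_ess X_ess this] le[of n] show ?thesis by simp
  qed
  ultimately show ?thesis
    by (intro LIMSEQ_le_const2) auto
qed

section \<open>Compactness of the feasible set\<close>

theorem lemma4p4:
  fixes M :: "'a measure"
    and \<rho>\<^sub>1 :: "('a \<Rightarrow> real) set \<Rightarrow> real"
    and K\<^sub>1 K\<^sub>2 :: "'a \<Rightarrow> real"
    and \<alpha> :: real
  assumes "prob_space M"
    and "K\<^sub>1 \<in> ess_bounded M" and "K\<^sub>2 \<in> ess_bounded M"
    and "AE x in M. 0 \<le> K\<^sub>1 x \<and> K\<^sub>1 x < K\<^sub>2 x"
    and "convex_expectation M \<rho>\<^sub>1"
    and "continuous_from_below M \<rho>\<^sub>1"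
    and "\<rho>\<^sub>1 (ae_class M K\<^sub>1) \<le> \<alpha>" and "\<alpha> \<le> \<rho>\<^sub>1 (ae_class M K\<^sub>2)"
  shows "compactin (Linf_weak_star M)
           {ae_class M X | X. X \<in> ess_bounded M \<and> (AE x in M. K\<^sub>1 x \<le> X x \<and> X x \<le> K\<^sub>2 x) \<and>
              \<rho>\<^sub>1 (ae_class M X) \<le> \<alpha>}"
proof -
  interpret prob_space M by fact
  define S where "S = {X \<in> ess_bounded M. (AE x in M. K\<^sub>1 x \<le> X x \<and> X x \<le> K\<^sub>2 x) \<and>
      \<rho>\<^sub>1 (ae_class M X) \<le> \<alpha>}"
  obtain C where C: "AE x in M. \<bar>K\<^sub>2 x\<bar> \<le> C"
    using assms(3) by (auto simp: ess_bounded_def)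
  define B where "B = \<bar>C\<bar>"
  have meas: "S \<subseteq> borel_measurable M"
    by (auto simp: S_def dest: ess_bounded_measurable)
  have bdd: "AE x in M. \<bar>X x\<bar> \<le> B" if "X \<in> S" for X
  proof -
    have "AE x in M. K\<^sub>1 x \<le> X x \<and> X x \<le> K\<^sub>2 x"
      using that by (simp add: S_def)
    then show ?thesis
      using assms(4) C by eventually_elim (auto simp: B_def)
  qed
  have convex: "convex_functions S"
    unfolding convex_functions_def
  proof (intro ballI)
    fix f g and t :: real assume f: "f \<in> S" and g: "g \<in> S" and t: "t \<in> {0..1}"
    have ess: "(\<lambda>x. t * f x + (1 - t) * g x) \<in> ess_bounded M"
      using f g by (auto simp: S_def intro!: ess_bounded_intros)
    have "AE x in M. K\<^sub>1 x \<le> f x \<and> f x \<le> K\<^sub>2 x" "AE x in M. K\<^sub>1 x \<le> g x \<and> g x \<le> K\<^sub>2 x"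
      using f g by (auto simp: S_def)
    then have between: "AE x in M. K\<^sub>1 x \<le> t * f x + (1 - t) * g x \<and> t * f x + (1 - t) * g x \<le> K\<^sub>2 x"
    proof eventually_elim
      case (elim x)
      have "t * K\<^sub>1 x + (1 - t) * K\<^sub>1 x \<le> t * f x + (1 - t) * g x"
        using elim t by (intro add_mono mult_left_mono) auto
      moreover have "t * f x + (1 - t) * g x \<le> t * K\<^sub>2 x + (1 - t) * K\<^sub>2 x"
        using elim t by (intro add_mono mult_left_mono) auto
      ultimately show ?case by (simp add: algebra_simps)
    qed
    have "\<rho>\<^sub>1 (ae_class M (\<lambda>x. t * f x + (1 - t) * g x))
        \<le> t * \<rho>\<^sub>1 (ae_class M f) + (1 - t) * \<rho>\<^sub>1 (ae_class M g)"
      using convex_expectation_convex[OF assms(5) _ _ t] f g by (simp add: S_def)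
    also have "\<dots> \<le> t * \<alpha> + (1 - t) * \<alpha>"
      using f g t by (intro add_mono mult_left_mono) (auto simp: S_def)
    finally show "(\<lambda>x. t * f x + (1 - t) * g x) \<in> S"
      using ess between by (simp add: S_def algebra_simps)
  qed
  have closed: "ae_closed M S"
    unfolding ae_closed_def
  proof (intro allI impI, elim conjE)
    fix u :: "nat \<Rightarrow> 'a \<Rightarrow> real" and f
    assume u: "\<forall>n. u n \<in> S" and f: "f \<in> borel_measurable M"
      and lim: "AE x in M. (\<lambda>n. u n x) \<longlonglongrightarrow> f x"
    have "AE x in M. \<forall>n. K\<^sub>1 x \<le> u n x \<and> u n x \<le> K\<^sub>2 x"
      using u by (simp add: AE_all_countable S_def)
    then have between: "AE x in M. K\<^sub>1 x \<le> f x \<and> f x \<le> K\<^sub>2 x"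
      using lim
    proof eventually_elim
      case (elim x)
      then show ?case using LIMSEQ_le_const[OF elim(2)] LIMSEQ_le_const2[OF elim(2)] by auto
    qed
    then have "AE x in M. \<bar>f x\<bar> \<le> B"
      using assms(4) C by eventually_elim (auto simp: B_def)
    then have "f \<in> ess_bounded M"
      using f by (intro ess_boundedI)
    moreover have "\<rho>\<^sub>1 (ae_class M f) \<le> \<alpha>"
    proof (rule convex_expectation_Fatou[OF assms(5,6) _ f _ lim])
      show "u n \<in> borel_measurable M" "AE x in M. \<bar>u n x\<bar> \<le> B" "\<rho>\<^sub>1 (ae_class M (u n)) \<le> \<alpha>" for n
        using u meas bdd by (auto simp: S_def)
    qed
    ultimately show "f \<in> S"
      using between by (simp add: S_def)
  qed
  have "closedin (Linf_weak_star M) (ae_class M ` S)"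
    using meas bdd convex closed by (intro closedin_weak_star_if_ae_closed) auto
  then have "compactin (Linf_weak_star M) (ae_class M ` S)"
  proof (rule closed_compactin[rotated 2])
    show "compactin (Linf_weak_star M)
        {ae_class M X | X. X \<in> borel_measurable M \<and> (AE x in M. \<bar>X x\<bar> \<le> B)}"
      by (rule compactin_weak_star_ball) (simp add: B_def)
    show "ae_class M ` S \<subseteq> {ae_class M X | X. X \<in> borel_measurable M \<and> (AE x in M. \<bar>X x\<bar> \<le> B)}"
      using meas bdd by blast
  qed
  also have "ae_class M ` S = {ae_class M X | X. X \<in> ess_bounded M \<and>
      (AE x in M. K\<^sub>1 x \<le> X x \<and> X x \<le> K\<^sub>2 x) \<and> \<rho>\<^sub>1 (ae_class M X) \<le> \<alpha>}"
    by (auto simp: S_def)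
  finally show ?thesis .
qed

end
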